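(* Let $0<p<1$ and let $\{X_n;\,n\ge1\}$ be a sequence of independent copies of a $\mathbf{B}$-valued random variable $X$, with $S_n=\sum_{k=1}^n X_k$. Then \[ \sum_{n=1}^{\infty}\frac1n\left(\frac{\|S_n\|}{n^{1/p}}\right)<\infty\ \text{ almost surely} \quad\text{if and only if}\quad \mathbb{E}\|X\|^p<\infty . \] Furthermore, \[ \sum_{n=1}^{\infty}\frac1n\left(\frac{\mathbb{E}\|S_n\|}{n^{1/p}}\right)<\infty \quad\text{if and only if}\quad \mathbb{E}\|X\|<\infty . \]
   Context: $(\mathbf{B},\|\cdot\|)$ is a real separable Banach space with its Borel $\sigma$-algebra. *)

theory Defs
  imports "HOL-Probability.Probability"
begin

(* partial sums S_n = X_1 + ... + X_n, with the sequence indexed from 0: X 0, ..., X (n-1) *)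
definition partial_sum :: "(nat \<Rightarrow> 'a \<Rightarrow> 'b::real_normed_vector) \<Rightarrow> nat \<Rightarrow> 'a \<Rightarrow> 'b" where
  "partial_sum Xs n \<omega> = (\<Sum>k<n. Xs k \<omega>)"

end

theory Submission
  imports Defs
begin

text \<open>
  If \<open>E \<parallel>X\<parallel>\<^sup>p < \<infinity>\<close>, then \<open>\<Sum>k. min 1 (\<parallel>X\<^sub>k\<parallel> / k\<^bsup>1/p\<^esup>)\<close> has finite expectation, so
  \<open>\<Sum>k. \<parallel>X\<^sub>k\<parallel> / k\<^bsup>1/p\<^esup>\<close> converges almost surely, and exchanging the order of summation gives the series of the
  partial sums.

  Conversely, put \<open>N = 8\<^sup>i\<close> and let \<open>W\<^sub>i\<close> be the average of the norms of the increments
  \<open>S(4N + d) - S(N + d)\<close> over \<open>d < N\<close>. These averages use disjoint blocks of the \<open>X\<^sub>k\<close>, hence are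
  independent, and convergence of the series forces \<open>W\<^sub>i / N\<^bsup>1/p\<^esup> \<rightarrow> 0\<close> almost surely. By the second
  Borel-Cantelli lemma \<open>P(W\<^sub>i > N\<^bsup>1/p\<^esup> / 2)\<close> is summable. Every \<open>X\<^sub>k\<close> with \<open>2N \<le> k < 4N\<close> occurs in all
  the increments, and a single large one makes \<open>W\<^sub>i\<close> large unless the remaining terms cancel it;
  as they are independent of \<open>X\<^sub>k\<close> and small in probability, no symmetrization is needed, and
  \<open>N P(\<parallel>X\<parallel> > N\<^bsup>1/p\<^esup>) \<le> P(W\<^sub>i > N\<^bsup>1/p\<^esup> / 2)\<close> for large \<open>i\<close>.
\<close>

section \<open>Elementary estimates for sums of powers\<close>

lemma powr_tail_step:
  fixes s x :: real
  assumes "s > 0" "x > 0"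
  shows "s * (x + 1) powr (- 1 - s) \<le> x powr (- s) - (x + 1) powr (- s)"
proof -
  have "\<exists>z>x. z < x + 1 \<and> (x + 1) powr (- s) - x powr (- s) = (x + 1 - x) * (- s * z powr (- s - 1))"
    using assms by (intro MVT2) (auto intro!: derivative_eq_intros)
  then obtain z where z: "x < z" "z < x + 1"
    "(x + 1) powr (- s) - x powr (- s) = - s * z powr (- s - 1)" by auto
  have "(x + 1) powr (- s - 1) \<le> z powr (- s - 1)"
    using z assms by (intro powr_mono2') auto
  hence "s * (x + 1) powr (- s - 1) \<le> s * z powr (- s - 1)"
    using assms by simp
  with z(3) have "s * (x + 1) powr (- s - 1) \<le> x powr (- s) - (x + 1) powr (- s)"
    by linarith
  moreover have "- 1 - s = - s - 1" by simp
  ultimately show ?thesis by metis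
qed

text \<open>Telescoping \<open>powr_tail_step\<close> controls the terms from \<open>Suc k\<close>
  on and gives the part \<open>1 / s\<close>. The first term is split off and accounts for the
  additional 1.\<close>

lemma powr_tail_sum_le:
  fixes s :: real
  assumes "s > 0"
  shows "(\<Sum>n=k..<m. real (Suc n) powr (- 1 - s)) \<le> (1 + 1 / s) * real (Suc k) powr (- s)"
proof (cases "k < m")
  case True
  have "s * (\<Sum>n=Suc k..<m. real (Suc n) powr (- 1 - s))
      = (\<Sum>n=k..<m-1. s * (real (Suc n) + 1) powr (- 1 - s))"
    using True sum.shift_bounds_Suc_ivl[of "\<lambda>n. s * real (Suc n) powr (- 1 - s)" k "m - 1"]
    by (simp add: sum_distrib_left algebra_simps)
  also have "\<dots> \<le> (\<Sum>n=k..<m-1. real (Suc n) powr (- s) - real (Suc (Suc n)) powr (- s))"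
    using powr_tail_step[OF assms, of "real (Suc _)"] by (intro sum_mono) (simp add: algebra_simps)
  also have "\<dots> = real (Suc k) powr (- s) - real m powr (- s)"
    using sum_Suc_diff'[of k "m - 1" "\<lambda>n. - (real (Suc n) powr (- s))"] True by simp
  also have "\<dots> \<le> real (Suc k) powr (- s)" by simp
  finally have *: "(\<Sum>n=Suc k..<m. real (Suc n) powr (- 1 - s)) \<le> 1 / s * real (Suc k) powr (- s)"
    using assms by (simp add: field_simps)
  have "real (Suc k) powr (- 1 - s) \<le> real (Suc k) powr (- s)"
    by (intro powr_mono) auto
  with * show ?thesis
    using True by (simp add: sum.atLeast_Suc_lessThan algebra_simps)
next
  case False
  then show ?thesis using assms by simp
qed

text \<open>After exchanging the order of summation, \<open>x k\<close> carries the total weight of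
  all n >= k, a tail sum of the powers -1 - a, which \<open>powr_tail_sum_le\<close> bounds by a
  multiple of \<open>real (Suc k) powr (- a)\<close>.\<close>

lemma summable_weighted_partial_sums:
  fixes x :: "nat \<Rightarrow> real" and a :: real
  assumes "a > 0" and nonneg: "\<And>k. 0 \<le> x k"
    and "summable (\<lambda>k. x k / real (Suc k) powr a)"
  shows "summable (\<lambda>n. 1 / real (Suc n) * ((\<Sum>k<Suc n. x k) / real (Suc n) powr a))"
proof (rule summableI_nonneg_bounded)
  show "0 \<le> 1 / real (Suc n) * ((\<Sum>k<Suc n. x k) / real (Suc n) powr a)" for n
    by (intro mult_nonneg_nonneg divide_nonneg_nonneg sum_nonneg nonneg) auto
  fix N
  have eq: "1 / real (Suc n) * (y / real (Suc n) powr a) = y * real (Suc n) powr (- 1 - a)" for n y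
    by (simp add: powr_diff powr_minus divide_simps)
  have "(\<Sum>n<N. 1 / real (Suc n) * ((\<Sum>k<Suc n. x k) / real (Suc n) powr a))
      = (\<Sum>n<N. \<Sum>k<Suc n. x k * real (Suc n) powr (- 1 - a))"
    by (simp only: eq sum_distrib_right)
  also have "\<dots> = (\<Sum>n<N. \<Sum>k<N. if k \<le> n then x k * real (Suc n) powr (- 1 - a) else 0)"
  proof (rule sum.cong[OF refl])
    fix n assume "n \<in> {..<N}"
    hence "{..<Suc n} = {k\<in>{..<N}. k \<le> n}" by auto
    thus "(\<Sum>k<Suc n. x k * real (Suc n) powr (- 1 - a))
        = (\<Sum>k<N. if k \<le> n then x k * real (Suc n) powr (- 1 - a) else 0)"
      by (simp only: sum.inter_filter[OF finite_lessThan])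
  qed
  also have "\<dots> = (\<Sum>k<N. \<Sum>n<N. if k \<le> n then x k * real (Suc n) powr (- 1 - a) else 0)"
    by (rule sum.swap)
  also have "\<dots> = (\<Sum>k<N. x k * (\<Sum>n=k..<N. real (Suc n) powr (- 1 - a)))"
  proof (rule sum.cong[OF refl])
    fix k
    have "{k..<N} = {n\<in>{..<N}. k \<le> n}" by auto
    thus "(\<Sum>n<N. if k \<le> n then x k * real (Suc n) powr (- 1 - a) else 0)
        = x k * (\<Sum>n=k..<N. real (Suc n) powr (- 1 - a))"
      unfolding sum_distrib_left by (simp only: sum.inter_filter[OF finite_lessThan])
  qed
  also have "\<dots> \<le> (\<Sum>k<N. x k * ((1 + 1 / a) * real (Suc k) powr (- a)))"
    by (intro sum_mono mult_left_mono powr_tail_sum_le nonneg assms)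
  also have "\<dots> = (1 + 1 / a) * (\<Sum>k<N. x k / real (Suc k) powr a)"
    by (simp add: sum_distrib_left powr_minus divide_inverse mult_ac)
  also have "\<dots> \<le> (1 + 1 / a) * (\<Sum>k. x k / real (Suc k) powr a)"
    using assms by (intro mult_left_mono sum_le_suminf) auto
  finally show "(\<Sum>n<N. 1 / real (Suc n) * ((\<Sum>k<Suc n. x k) / real (Suc n) powr a))
      \<le> (1 + 1 / a) * (\<Sum>k. x k / real (Suc k) powr a)" .
qed

text \<open>The sum is cut at about k = \<open>y powr p\<close>. Below the cut each term is at most
  1, which contributes at most \<open>y powr p\<close>. Beyond it the tail bound applies with
  \<open>s = 1 / p - 1\<close>, positive because p < 1, and contributes \<open>1 + 1 / s\<close>
  times \<open>y powr p\<close>.\<close>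

lemma truncated_powr_sum_le:
  fixes p y :: real
  assumes "0 < p" "p < 1" "0 \<le> y"
  shows "(\<Sum>k<N. min 1 (y / real (Suc k) powr (1 / p))) \<le> (2 + 1 / (1 / p - 1)) * y powr p"
proof (cases "y = 0")
  case True
  then show ?thesis by simp
next
  case False
  define s where "s = 1 / p - 1"
  have s: "s > 0" "1 / p = 1 + s" using assms by (auto simp: s_def field_simps)
  define t where "t = y powr p"
  have t: "t > 0" using False by (simp add: t_def)
  \<comment> \<open>With \<open>y\<close> written as a power of the cut \<open>t\<close>, the tail
    bound \<open>y * t powr (- s)\<close> collapses to \<open>t\<close>.\<close>
  have y: "y = t powr (1 + s)" using assms False s by (simp add: t_def powr_powr flip: s(2))
  define k0 where "k0 = nat \<lfloor>t\<rfloor>"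
  have k0: "real k0 \<le> t" "t \<le> real (Suc k0)" using t by (simp_all add: k0_def) linarith
  \<comment> \<open>Only an inequality, since \<open>k0\<close> may exceed \<open>N\<close>; the
    added terms are nonnegative.\<close>
  have "(\<Sum>k<N. min 1 (y / real (Suc k) powr (1 / p)))
      \<le> (\<Sum>k\<in>{..<k0} \<union> {k0..<N}. min 1 (y / real (Suc k) powr (1 / p)))"
    using assms by (intro sum_mono2) auto
  also have "\<dots> = (\<Sum>k<k0. min 1 (y / real (Suc k) powr (1 / p)))
      + (\<Sum>k=k0..<N. min 1 (y / real (Suc k) powr (1 / p)))"
    by (intro sum.union_disjoint) auto
  also have "(\<Sum>k<k0. min 1 (y / real (Suc k) powr (1 / p))) \<le> (\<Sum>k<k0. 1)"
    by (intro sum_mono) auto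
  also have "(\<Sum>k<k0. 1) \<le> t" using k0 by simp
  also have "(\<Sum>k=k0..<N. min 1 (y / real (Suc k) powr (1 / p)))
      \<le> (\<Sum>k=k0..<N. y * real (Suc k) powr (- 1 - s))"
    by (intro sum_mono min.coboundedI2) (simp add: s powr_diff powr_add powr_minus divide_simps)
  also have "\<dots> \<le> y * ((1 + 1 / s) * real (Suc k0) powr (- s))"
    unfolding sum_distrib_left[symmetric]
    using assms s by (intro mult_left_mono powr_tail_sum_le) auto
  also have "\<dots> \<le> y * ((1 + 1 / s) * t powr (- s))"
    using assms s t k0 by (intro mult_left_mono powr_mono2') auto
  also have "\<dots> = (1 + 1 / s) * t"
    using t by (simp add: y powr_add powr_minus)
  finally show ?thesis
    unfolding s_def[symmetric] t_def[symmetric] by (simp add: algebra_simps)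
qed

text \<open>A discrete layer-cake bound: if y > 1 lies between \<open>8 ^ i\<close> (exclusive) and
  \<open>8 ^ Suc i\<close> (inclusive), the single term with index \<open>i\<close> already
  dominates it. Integrated, it bounds a moment by tail probabilities at geometric scales.\<close>

lemma ennreal_le_geometric_tail_sum:
  fixes y :: real
  shows "ennreal y \<le> 1 + (\<Sum>i. ennreal (8 ^ Suc i) * indicator {8 ^ i<..} y)"
proof (cases "y \<le> 1")
  case True
  then show ?thesis by (intro add_increasing2) auto
next
  case False
  obtain m where m: "y < 8 ^ m" using real_arch_pow[of 8 y] by auto
  define n where "n = (LEAST n. y \<le> 8 ^ n)"
  have n: "y \<le> 8 ^ n" unfolding n_def using m by (rule LeastI[OF less_imp_le])
  have "n \<noteq> 0" using n False by (cases n) auto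
  then obtain i where i: "n = Suc i" by (cases n) auto
  have "\<not> y \<le> 8 ^ i" using not_less_Least[of i "\<lambda>n. y \<le> 8 ^ n"] i n_def by auto
  hence "ennreal y \<le> ennreal (8 ^ Suc i) * indicator {8 ^ i<..} y"
    using n i by (auto intro!: ennreal_leI)
  also have "\<dots> = (\<Sum>j\<in>{i}. ennreal (8 ^ Suc j) * indicator {8 ^ j<..} y)"
    by (simp only: sum.insert[OF finite.emptyI] sum.empty empty_iff not_False_eq_True add_0_right)
  also have "\<dots> \<le> (\<Sum>j. ennreal (8 ^ Suc j) * indicator {8 ^ j<..} y)"
    by (intro sum_le_suminf) auto
  finally show ?thesis by (intro add_increasing) auto
qed

section \<open>Independence: Borel-Cantelli and the effect of a single large term\<close>

context prob_space begin

text \<open>Continuity from above: the tail unions decrease to the event that \<open>P i\<close>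
  occurs infinitely often, which is null.\<close>

lemma prob_tendsto_0_if_AE_eventually_not:
  assumes [measurable]: "\<And>i::nat. Measurable.pred M (P i)"
    and "AE \<omega> in M. eventually (\<lambda>i. \<not> P i \<omega>) sequentially"
  shows "(\<lambda>i. prob (\<Union>j\<in>{i..}. {\<omega>\<in>space M. P j \<omega>})) \<longlonglongrightarrow> 0"
    and "(\<lambda>i. prob {\<omega>\<in>space M. P i \<omega>}) \<longlonglongrightarrow> 0"
proof -
  let ?D = "\<lambda>i. \<Union>j\<in>{i..}. {\<omega>\<in>space M. P j \<omega>}"
  have [measurable]: "?D i \<in> events" for i by measurable
  have "(\<lambda>i. prob (?D i)) \<longlonglongrightarrow> prob (\<Inter>i. ?D i)"
    by (intro finite_Lim_measure_decseq) (auto simp: decseq_def intro: order_trans)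
  also have "prob (\<Inter>i. ?D i) = 0"
    using assms(2) by (subst prob_eq_0) (auto simp: eventually_sequentially elim!: eventually_mono)
  finally show D: "(\<lambda>i. prob (?D i)) \<longlonglongrightarrow> 0" .
  show "(\<lambda>i. prob {\<omega>\<in>space M. P i \<omega>}) \<longlonglongrightarrow> 0"
    by (rule tendsto_sandwich[OF _ _ tendsto_const D])
      (auto intro!: always_eventually finite_measure_mono)
qed

text \<open>The second Borel-Cantelli lemma in contrapositive form. From some \<open>m\<close> on,
  no exceedance occurs with probability at least 1/2. By independence and 1 - x <= exp (-x), that
  probability is at most the exponential of minus the sum of the exceedance probabilities, so the
  sum is at most \<open>ln 2\<close>.\<close>

lemma borel_cantelli_indep_vars:
  fixes G :: "nat \<Rightarrow> 'a \<Rightarrow> real"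
  assumes ind: "indep_vars (\<lambda>_. borel) G UNIV"
    and ev: "AE \<omega> in M. eventually (\<lambda>i. G i \<omega> \<le> c) sequentially"
  shows "summable (\<lambda>i. prob {\<omega>\<in>space M. G i \<omega> > c})"
proof -
  have [measurable]: "G i \<in> borel_measurable M" for i
    using ind by (auto simp: indep_vars_def)
  let ?P = "\<lambda>i. prob {\<omega>\<in>space M. G i \<omega> > c}"
  have "(\<lambda>i. prob (\<Union>j\<in>{i..}. {\<omega>\<in>space M. c < G j \<omega>})) \<longlonglongrightarrow> 0"
    using ev by (intro prob_tendsto_0_if_AE_eventually_not) (auto simp: not_less)
  hence "eventually (\<lambda>i. prob (\<Union>j\<in>{i..}. {\<omega>\<in>space M. c < G j \<omega>}) < 1/2) sequentially"
    by (rule order_tendstoD) simp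
  then obtain m where m: "prob (\<Union>j\<in>{m..}. {\<omega>\<in>space M. c < G j \<omega>}) < 1/2"
    by (auto simp: eventually_sequentially)
  have bound: "(\<Sum>i=m..<n. ?P i) \<le> ln 2" for n
  proof (cases "m < n")
    \<comment> \<open>A nonempty index range is needed: an empty intersection would be the whole
      type instead of \<open>space M\<close>.\<close>
    case True
    have "1/2 \<le> 1 - prob (\<Union>j\<in>{m..}. {\<omega>\<in>space M. c < G j \<omega>})" using m by simp
    also have "\<dots> = prob (space M - (\<Union>j\<in>{m..}. {\<omega>\<in>space M. c < G j \<omega>}))"
      by (intro prob_compl[symmetric]) measurable
    also have "\<dots> \<le> prob (\<Inter>i\<in>{m..<n}. G i -` {..c} \<inter> space M)"
      using True by (intro finite_measure_mono) (auto simp: not_less)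
    also have "\<dots> = (\<Prod>i=m..<n. prob (G i -` {..c} \<inter> space M))"
      using True by (intro indep_varsD[OF ind]) auto
    also have "\<dots> = (\<Prod>i=m..<n. 1 - ?P i)"
    proof (intro prod.cong refl)
      fix i
      have "G i -` {..c} \<inter> space M = space M - {\<omega>\<in>space M. G i \<omega> > c}" by auto
      thus "prob (G i -` {..c} \<inter> space M) = 1 - ?P i"
        by (simp add: prob_compl)
    qed
    also have "\<dots> \<le> (\<Prod>i=m..<n. exp (- ?P i))"
      using exp_ge_add_one_self[of "- ?P _"] by (intro prod_mono) auto
    also have "\<dots> = exp (- (\<Sum>i=m..<n. ?P i))" by (simp add: exp_sum flip: sum_negf)
    finally have "ln (1/2) \<le> ln (exp (- (\<Sum>i=m..<n. ?P i)))" by (subst ln_le_cancel_iff) auto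
    thus ?thesis by (simp add: ln_div)
  qed auto
  have "summable (\<lambda>i. ?P (i + m))"
  proof (rule summableI_nonneg_bounded)
    show "(\<Sum>i<n. ?P (i + m)) \<le> ln 2" for n
      using bound[of "n + m"] sum.shift_bounds_nat_ivl[of ?P 0 m n]
      by (simp add: lessThan_atLeast0)
  qed auto
  thus ?thesis by (rule iffD1[OF summable_iff_shift])
qed

text \<open>Since \<open>K\<close> is contained in every \<open>A d\<close>, each
  \<open>Xs k\<close> with k in \<open>K\<close> enters all the averaged sums, so \<open>W\<close>
  is at least \<open>norm (Xs k)\<close> minus the average \<open>Y k\<close> of the sums without
  it. If \<open>norm (Xs k)\<close> exceeds \<open>b\<close> and \<open>Y k\<close> is at most
  \<open>b / 2\<close>, then \<open>W\<close> exceeds \<open>b / 2\<close>. The remaining terms are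
  independent of \<open>Xs k\<close> and well behaved with probability at least 1/2; adding up
  disjoint events over \<open>K\<close> gives the bound.\<close>

lemma single_jump_lower_bound:
  fixes Xs :: "nat \<Rightarrow> 'a \<Rightarrow> 'b::{real_normed_vector, second_countable_topology}"
    and A :: "nat \<Rightarrow> nat set"
  assumes ind: "indep_vars (\<lambda>_. borel) Xs UNIV"
    and q: "\<And>k. prob {\<omega>\<in>space M. b < norm (Xs k \<omega>)} = q"
    and small: "\<And>k. prob {\<omega>\<in>space M. b / 4 < norm (Xs k \<omega>)} \<le> 1/8"
    and W: "\<And>\<omega>. W \<omega> = (\<Sum>d<N. norm (\<Sum>l\<in>A d. Xs l \<omega>)) / real N"
    and Wsmall: "prob {\<omega>\<in>space M. b / 4 < W \<omega>} \<le> 1/8"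
    and "N > 0" and fin: "\<And>d. d < N \<Longrightarrow> finite (A d)" and sub: "\<And>d. d < N \<Longrightarrow> K \<subseteq> A d"
    and "finite K" and Kq: "real (card K) * q \<le> 1/4"
  shows "real (card K) * q / 2 \<le> prob {\<omega>\<in>space M. b / 2 < W \<omega>}"
proof -
  have [measurable]: "Xs i \<in> borel_measurable M" for i
    using ind by (auto simp: indep_vars_def)
  have [measurable]: "W \<in> borel_measurable M"
    unfolding W[abs_def] by measurable
  define Y where "Y k x = (\<Sum>d<N. norm (\<Sum>l\<in>A d - {k}. x l)) / real N" for k and x :: "nat \<Rightarrow> 'b"
  \<comment> \<open>Requiring the other terms of \<^term>\<open>K\<close> to be small makes the events \<open>?E k\<close> below disjoint.\<close>
  define R where "R k x \<longleftrightarrow> Y k x \<le> b / 2 \<and> (\<forall>l\<in>K - {k}. norm (x l) \<le> b)" for k and x :: "nat \<Rightarrow> 'b"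
  have YM[measurable]: "(\<lambda>\<omega>. Y k (\<lambda>l. Xs l \<omega>)) \<in> borel_measurable M" for k
    unfolding Y_def by measurable
  have RM[measurable]: "Measurable.pred M (\<lambda>\<omega>. R k (\<lambda>l. Xs l \<omega>))" for k
    unfolding R_def using \<open>finite K\<close> by measurable
  have split: "(\<Sum>l\<in>A d. Xs l \<omega>) = Xs k \<omega> + (\<Sum>l\<in>A d - {k}. Xs l \<omega>)"
    if "d < N" "k \<in> K" for d k \<omega>
    using that fin sub by (intro sum.remove) auto
  have YW: "Y k (\<lambda>l. Xs l \<omega>) \<le> W \<omega> + norm (Xs k \<omega>)" if "k \<in> K" for k \<omega>
  proof -
    have "(\<Sum>d<N. norm (\<Sum>l\<in>A d - {k}. Xs l \<omega>))
        \<le> (\<Sum>d<N. norm (\<Sum>l\<in>A d. Xs l \<omega>) + norm (Xs k \<omega>))"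
      using that split by (intro sum_mono) (metis add.commute add_diff_cancel_left' lessThan_iff norm_triangle_ineq4)
    thus ?thesis using \<open>N > 0\<close>
      by (simp add: Y_def W sum.distrib divide_simps mult.commute)
  qed
  have XW: "norm (Xs k \<omega>) \<le> W \<omega> + Y k (\<lambda>l. Xs l \<omega>)" if "k \<in> K" for k \<omega>
  proof -
    have "(\<Sum>d<N. norm (Xs k \<omega>))
        \<le> (\<Sum>d<N. norm (\<Sum>l\<in>A d. Xs l \<omega>) + norm (\<Sum>l\<in>A d - {k}. Xs l \<omega>))"
      using that split by (intro sum_mono) (metis add_diff_cancel_right' lessThan_iff norm_triangle_ineq4)
    thus ?thesis using \<open>N > 0\<close>
      by (simp add: Y_def W sum.distrib divide_simps mult.commute)
  qed
  \<comment> \<open>If \<open>W\<close> and \<open>norm (Xs k)\<close> are both at most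
    \<open>b / 4\<close>, then \<open>Y k\<close> is at most \<open>b / 2\<close> by
    \<open>YW\<close>. The exceptional probabilities 1/8, 1/8 and, by a union bound over
    \<open>K\<close>, 1/4 add up to 1/2.\<close>
  have R: "1/2 \<le> prob {\<omega>\<in>space M. R k (\<lambda>l. Xs l \<omega>)}" if k: "k \<in> K" for k
  proof -
    let ?U = "({\<omega>\<in>space M. b / 4 < W \<omega>} \<union> {\<omega>\<in>space M. b / 4 < norm (Xs k \<omega>)})
        \<union> (\<Union>l\<in>K. {\<omega>\<in>space M. b < norm (Xs l \<omega>)})"
    have "space M - {\<omega>\<in>space M. R k (\<lambda>l. Xs l \<omega>)} \<subseteq> ?U"
    proof
      fix \<omega> assume \<omega>: "\<omega> \<in> space M - {\<omega>\<in>space M. R k (\<lambda>l. Xs l \<omega>)}"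
      show "\<omega> \<in> ?U" using \<omega> YW[OF k, of \<omega>] by (fastforce simp: R_def not_le)
    qed
    hence "1 - prob {\<omega>\<in>space M. R k (\<lambda>l. Xs l \<omega>)} \<le> prob ?U"
      using \<open>finite K\<close> by (subst prob_compl[symmetric]) (auto intro!: finite_measure_mono)
    also have "\<dots> \<le> prob ({\<omega>\<in>space M. b / 4 < W \<omega>} \<union> {\<omega>\<in>space M. b / 4 < norm (Xs k \<omega>)})
        + prob (\<Union>l\<in>K. {\<omega>\<in>space M. b < norm (Xs l \<omega>)})"
      using \<open>finite K\<close> by (intro measure_Un_le) auto
    also have "prob ({\<omega>\<in>space M. b / 4 < W \<omega>} \<union> {\<omega>\<in>space M. b / 4 < norm (Xs k \<omega>)})
        \<le> prob {\<omega>\<in>space M. b / 4 < W \<omega>} + prob {\<omega>\<in>space M. b / 4 < norm (Xs k \<omega>)}"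
      by (intro measure_Un_le) auto
    also have "prob (\<Union>l\<in>K. {\<omega>\<in>space M. b < norm (Xs l \<omega>)})
        \<le> (\<Sum>l\<in>K. prob {\<omega>\<in>space M. b < norm (Xs l \<omega>)})"
      using \<open>finite K\<close> by (intro finite_measure_subadditive_finite) auto
    also have "\<dots> \<le> 1/4" using Kq by (simp add: q)
    finally show ?thesis using Wsmall small[of k] by linarith
  qed
  let ?E = "\<lambda>k. {\<omega>\<in>space M. b < norm (Xs k \<omega>) \<and> R k (\<lambda>l. Xs l \<omega>)}"
  have E: "prob (?E k) = q * prob {\<omega>\<in>space M. R k (\<lambda>l. Xs l \<omega>)}" if k: "k \<in> K" for k
  proof -
    let ?B = "UNIV - {k}"
    let ?S = "\<lambda>I. PiM I (\<lambda>_. borel) :: (nat \<Rightarrow> 'b) measure"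
    have ind2: "indep_var (?S {k}) (\<lambda>\<omega>. restrict (\<lambda>i. Xs i \<omega>) {k}) (?S ?B) (\<lambda>\<omega>. restrict (\<lambda>i. Xs i \<omega>) ?B)"
      by (intro indep_var_restrict[OF ind]) auto
    \<comment> \<open>\<open>R k\<close> reads only coordinates other than \<open>k\<close>, so it
      is an event of the restricted family that is independent of \<open>Xs k\<close>.\<close>
    have RB: "R k (restrict x ?B) \<longleftrightarrow> R k x" for x
      by (simp add: R_def Y_def)
    have Ym: "Y k \<in> borel_measurable (?S ?B)"
      unfolding Y_def by (intro borel_measurable_divide borel_measurable_sum borel_measurable_norm
          measurable_component_singleton) auto
    have "{x\<in>space (?S ?B). Y k x \<le> b / 2} \<inter> {x\<in>space (?S ?B). \<forall>l\<in>K - {k}. norm (x l) \<le> b} \<in> sets (?S ?B)"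
      using \<open>finite K\<close> Ym
      by (intro sets.Int borel_measurable_le borel_measurable_const sets.sets_Collect_finite_All
          borel_measurable_norm measurable_component_singleton) auto
    also have "{x\<in>space (?S ?B). Y k x \<le> b / 2} \<inter> {x\<in>space (?S ?B). \<forall>l\<in>K - {k}. norm (x l) \<le> b}
        = {x\<in>space (?S ?B). R k x}" by (auto simp: R_def)
    finally have s2: "{x\<in>space (?S ?B). R k x} \<in> sets (?S ?B)" .
    have s1: "{x\<in>space (?S {k}). b < norm (x k)} \<in> sets (?S {k})"
      by (intro borel_measurable_less borel_measurable_const borel_measurable_norm
          measurable_component_singleton) auto
    have "?E k = (\<lambda>\<omega>. (restrict (\<lambda>i. Xs i \<omega>) {k}, restrict (\<lambda>i. Xs i \<omega>) ?B)) -`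
        ({x\<in>space (?S {k}). b < norm (x k)} \<times> {x\<in>space (?S ?B). R k x}) \<inter> space M"
      by (auto simp: RB space_PiM)
    also have "prob \<dots> = prob ((\<lambda>\<omega>. restrict (\<lambda>i. Xs i \<omega>) {k}) -` {x\<in>space (?S {k}). b < norm (x k)} \<inter> space M)
        * prob ((\<lambda>\<omega>. restrict (\<lambda>i. Xs i \<omega>) ?B) -` {x\<in>space (?S ?B). R k x} \<inter> space M)"
      by (rule indep_varD[OF ind2 s1 s2])
    also have "(\<lambda>\<omega>. restrict (\<lambda>i. Xs i \<omega>) {k}) -` {x\<in>space (?S {k}). b < norm (x k)} \<inter> space M
        = {\<omega>\<in>space M. b < norm (Xs k \<omega>)}" by (auto simp: space_PiM)
    also have "(\<lambda>\<omega>. restrict (\<lambda>i. Xs i \<omega>) ?B) -` {x\<in>space (?S ?B). R k x} \<inter> space M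
        = {\<omega>\<in>space M. R k (\<lambda>l. Xs l \<omega>)}" by (auto simp: space_PiM RB)
    finally show ?thesis by (simp add: q)
  qed
  have "q \<ge> 0" using q[of 0] measure_nonneg[of M] by metis
  have "real (card K) * q / 2 = (\<Sum>k\<in>K. q * (1/2))" by simp
  also have "\<dots> \<le> (\<Sum>k\<in>K. prob (?E k))"
  proof (rule sum_mono)
    fix k assume k: "k \<in> K"
    show "q * (1/2) \<le> prob (?E k)"
      unfolding E[OF k] by (intro mult_left_mono R k \<open>q \<ge> 0\<close>)
  qed
  also have "\<dots> = prob (\<Union>k\<in>K. ?E k)"
  proof (intro finite_measure_finite_Union[symmetric] \<open>finite K\<close>)
    show "disjoint_family_on ?E K"
      by (auto simp: disjoint_family_on_def R_def not_less[symmetric])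
  qed auto
  also have "\<dots> \<le> prob {\<omega>\<in>space M. b / 2 < W \<omega>}"
  proof (intro finite_measure_mono)
    show "(\<Union>k\<in>K. ?E k) \<subseteq> {\<omega>\<in>space M. b / 2 < W \<omega>}"
    proof safe
      fix k \<omega> assume "k \<in> K" "b < norm (Xs k \<omega>)" "R k (\<lambda>l. Xs l \<omega>)"
      thus "b / 2 < W \<omega>" using XW[of k \<omega>] by (simp add: R_def)
    qed
  qed auto
  finally show ?thesis .
qed

section \<open>The two implications between almost sure convergence and the moment of order
  p\<close>

lemma AE_summable_weighted_norms:
  fixes X :: "'a \<Rightarrow> 'b::{real_normed_vector, second_countable_topology}" and Xs :: "nat \<Rightarrow> 'a \<Rightarrow> 'b"
  assumes p: "0 < p" "p < 1"
    and [measurable]: "X \<in> borel_measurable M" "\<And>n. Xs n \<in> borel_measurable M"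
    and distr: "\<And>n. distr M borel (Xs n) = distr M borel X"
    and fin: "(\<integral>\<^sup>+ \<omega>. ennreal (norm (X \<omega>) powr p) \<partial>M) < \<infinity>"
  shows "AE \<omega> in M. summable (\<lambda>k. norm (Xs k \<omega>) / real (Suc k) powr (1 / p))"
proof -
  define U where "U k x = min 1 (norm x / real (Suc k) powr (1 / p))" for k and x :: 'b
  have [measurable]: "U k \<in> borel_measurable borel" for k
    unfolding U_def by measurable
  have U0: "0 \<le> U k x" for k x by (simp add: U_def)
  define c where "c = 2 + 1 / (1 / p - 1)"
  have c: "c \<ge> 0" using p by (simp add: c_def)
  have bound: "(\<Sum>k. ennreal (U k x)) \<le> ennreal (c * norm x powr p)" for x
  proof (rule suminf_le_const)
    fix N
    have "(\<Sum>k<N. ennreal (U k x)) = ennreal (\<Sum>k<N. U k x)" using U0 by (simp add: sum_ennreal)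
    also have "\<dots> \<le> ennreal (c * norm x powr p)"
      unfolding U_def c_def using p by (intro ennreal_leI truncated_powr_sum_le) auto
    finally show "(\<Sum>k<N. ennreal (U k x)) \<le> ennreal (c * norm x powr p)" .
  qed auto
  have eq: "(\<integral>\<^sup>+ \<omega>. ennreal (U k (Xs k \<omega>)) \<partial>M) = (\<integral>\<^sup>+ \<omega>. ennreal (U k (X \<omega>)) \<partial>M)" for k
  proof -
    have "(\<integral>\<^sup>+ \<omega>. ennreal (U k (Xs k \<omega>)) \<partial>M) = (\<integral>\<^sup>+ x. ennreal (U k x) \<partial>distr M borel (Xs k))"
      by (subst nn_integral_distr) auto
    also have "\<dots> = (\<integral>\<^sup>+ x. ennreal (U k x) \<partial>distr M borel X)" by (simp add: distr)
    also have "\<dots> = (\<integral>\<^sup>+ \<omega>. ennreal (U k (X \<omega>)) \<partial>M)" by (subst nn_integral_distr) auto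
    finally show ?thesis .
  qed
  \<comment> \<open>Termwise, \<open>Xs k\<close> has the law of \<open>X\<close>, so the expected
    sum may be computed with the single variable \<open>X\<close>, to which the pointwise
    \<open>bound\<close> applies.\<close>
  have "(\<integral>\<^sup>+ \<omega>. (\<Sum>k. ennreal (U k (Xs k \<omega>))) \<partial>M) = (\<integral>\<^sup>+ \<omega>. (\<Sum>k. ennreal (U k (X \<omega>))) \<partial>M)"
    by (simp add: nn_integral_suminf eq)
  also have "\<dots> \<le> (\<integral>\<^sup>+ \<omega>. ennreal c * ennreal (norm (X \<omega>) powr p) \<partial>M)"
    using bound c by (intro nn_integral_mono) (simp add: ennreal_mult)
  also have "\<dots> = ennreal c * (\<integral>\<^sup>+ \<omega>. ennreal (norm (X \<omega>) powr p) \<partial>M)"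
    by (intro nn_integral_cmult) measurable
  also have "\<dots> < \<infinity>" using fin by (simp add: ennreal_mult_less_top)
  finally have "AE \<omega> in M. (\<Sum>k. ennreal (U k (Xs k \<omega>))) \<noteq> \<infinity>"
    by (intro nn_integral_PInf_AE) auto
  thus ?thesis
  proof eventually_elim
    case (elim \<omega>)
    hence sU: "summable (\<lambda>k. U k (Xs k \<omega>))"
      using U0 by (intro summable_suminf_not_top) auto
    \<comment> \<open>Summable terms are eventually below 1, where the truncation in
      \<open>U\<close> is inactive.\<close>
    hence "eventually (\<lambda>k. U k (Xs k \<omega>) < 1) sequentially"
      by (intro order_tendstoD[OF summable_LIMSEQ_zero]) auto
    hence "eventually (\<lambda>k. norm (Xs k \<omega>) / real (Suc k) powr (1 / p) = U k (Xs k \<omega>)) sequentially"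
      by eventually_elim (auto simp: U_def min_def split: if_splits)
    with sU show ?case by (subst summable_cong)
  qed
qed

text \<open>Everything is reduced to summability of \<open>8 ^ i * q i\<close>, where
  \<open>q i\<close> is the probability that \<open>norm X\<close> exceeds \<open>b i\<close>, that
  is, that \<open>norm X powr p\<close> exceeds \<open>8 ^ i\<close>; the layer-cake bound then
  yields the moment.\<close>

lemma expectation_powr_finite_if_AE_summable:
  fixes X :: "'a \<Rightarrow> 'b::{real_normed_vector, second_countable_topology}" and Xs :: "nat \<Rightarrow> 'a \<Rightarrow> 'b"
  assumes p: "0 < p"
    and [measurable]: "X \<in> borel_measurable M" "\<And>n. Xs n \<in> borel_measurable M"
    and ind: "indep_vars (\<lambda>_. borel) Xs UNIV"
    and distr: "\<And>n. distr M borel (Xs n) = distr M borel X"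
    and AE: "AE \<omega> in M. summable (\<lambda>n. (1 / real (Suc n)) *
              (norm (partial_sum Xs (Suc n) \<omega>) / real (Suc n) powr (1 / p)))"
  shows "(\<integral>\<^sup>+ \<omega>. ennreal (norm (X \<omega>) powr p) \<partial>M) < \<infinity>"
proof -
  define a where "a = 1 / p"
  have a: "a > 0" using p by (simp add: a_def)
  define b where "b i = (8 ^ i) powr a" for i :: nat
  have b: "b i > 0" for i by (simp add: b_def)
  \<comment> \<open>With N = \<open>8 ^ i\<close> and d < N, each window contains all indices from
    2N up to 4N and stays below 5N. The windows of level \<open>i\<close> thus lie in the block from
    \<open>8 ^ i\<close> to \<open>8 ^ Suc i\<close>, and blocks of different levels are disjoint.
    \<open>Sw\<close> takes an arbitrary sequence so that it can be applied to the restriction to a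
    block.\<close>
  define Sw where "Sw i x = (\<Sum>d<8 ^ i. norm (\<Sum>l\<in>{8 ^ i + d..<4 * 8 ^ i + d}. x l)) / real (8 ^ i)"
    for i and x :: "nat \<Rightarrow> 'b"
  define W where "W i \<omega> = Sw i (\<lambda>l. Xs l \<omega>)" for i \<omega>
  have [measurable]: "W i \<in> borel_measurable M" for i
    unfolding W_def Sw_def by measurable
  define g where "g \<omega> n = norm (partial_sum Xs n \<omega>) * real n powr (- 1 - a)" for \<omega> n
  \<comment> \<open>The endpoints N + d and 4N + d run through disjoint ranges inside the block.
    There the weight of n differs from that of N, which is 1 / (N * \<open>b i\<close>), by a factor
    of at most \<open>8 powr (1 + a)\<close>.\<close>
  have Wg: "W i \<omega> / b i \<le> 8 powr (1 + a) * (\<Sum>n=8^i..<8^Suc i. g \<omega> n)" for i \<omega>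
  proof -
    let ?N = "8 ^ i :: nat"
    let ?h = "\<lambda>n. norm (partial_sum Xs n \<omega>)"
    have win: "(\<Sum>l\<in>{?N + d..<4 * ?N + d}. Xs l \<omega>) = partial_sum Xs (4 * ?N + d) \<omega> - partial_sum Xs (?N + d) \<omega>" for d
      by (simp add: partial_sum_def lessThan_atLeast0 sum_diff_nat_ivl)
    have "(\<Sum>d<?N. norm (\<Sum>l\<in>{?N + d..<4 * ?N + d}. Xs l \<omega>)) \<le> (\<Sum>d<?N. ?h (4 * ?N + d) + ?h (?N + d))"
      unfolding win by (intro sum_mono norm_triangle_ineq4)
    also have "\<dots> = (\<Sum>n=4*?N..<5*?N. ?h n) + (\<Sum>n=?N..<2*?N. ?h n)"
      using sum.shift_bounds_nat_ivl[of ?h 0 "4 * ?N" ?N] sum.shift_bounds_nat_ivl[of ?h 0 ?N ?N]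
      by (simp add: sum.distrib lessThan_atLeast0 add.commute flip: mult_2)
    also have "\<dots> = (\<Sum>n\<in>{4*?N..<5*?N} \<union> {?N..<2*?N}. ?h n)"
      by (intro sum.union_disjoint[symmetric]) auto
    also have "\<dots> \<le> (\<Sum>n=?N..<8*?N. ?h n)"
      by (intro sum_mono2) auto
    finally have "W i \<omega> / b i \<le> (\<Sum>n=?N..<8*?N. ?h n) / real ?N / b i"
      unfolding W_def Sw_def using b[of i] by (intro divide_right_mono) auto
    also have "\<dots> = (\<Sum>n=?N..<8*?N. ?h n * real ?N powr (- 1 - a))"
      by (simp add: b_def sum_distrib_right sum_divide_distrib powr_diff powr_minus divide_simps)
    also have "\<dots> \<le> (\<Sum>n=?N..<8*?N. ?h n * (8 powr (1 + a) * real n powr (- 1 - a)))"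
    proof (intro sum_mono mult_left_mono)
      fix n assume n: "n \<in> {?N..<8*?N}"
      hence n': "real n \<le> 8 * real ?N" "0 < real n"
        by (auto intro: less_le_trans[OF _ of_nat_mono] simp del: of_nat_power)
      have "8 powr (- 1 - a) * real ?N powr (- 1 - a) = (8 * real ?N) powr (- 1 - a)"
        by (simp add: powr_mult)
      also have "\<dots> \<le> real n powr (- 1 - a)"
        using n' a by (intro powr_mono2') auto
      finally have "8 powr (1 + a) * (8 powr (- 1 - a) * real ?N powr (- 1 - a)) \<le> 8 powr (1 + a) * real n powr (- 1 - a)"
        by (intro mult_left_mono) auto
      moreover have "8 powr (1 + a) * 8 powr (- 1 - a) = (1 :: real)"
        by (simp flip: powr_add)
      ultimately show "real ?N powr (- 1 - a) \<le> 8 powr (1 + a) * real n powr (- 1 - a)"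
        by (simp add: mult.assoc[symmetric])
    qed auto
    finally show ?thesis by (simp add: g_def sum_distrib_left mult_ac)
  qed
  \<comment> \<open>Block sums of a convergent series tend to 0 by the Cauchy criterion.\<close>
  have W0: "AE \<omega> in M. \<forall>c>0. eventually (\<lambda>i. W i \<omega> \<le> c * b i) sequentially"
    using AE
  proof eventually_elim
    case (elim \<omega>)
    have "summable (\<lambda>n. g \<omega> (Suc n))"
      using elim unfolding g_def a_def[symmetric]
      by (simp add: powr_diff powr_minus field_simps)
    hence sg: "summable (g \<omega>)" by (simp add: summable_Suc_iff)
    show ?case
    proof safe
      fix c :: real assume c: "c > 0"
      define e where "e = c / 8 powr (1 + a)"
      have "e > 0" using c by (simp add: e_def)
      then obtain m where m: "\<And>k n. k \<ge> m \<Longrightarrow> norm (sum (g \<omega>) {k..<n}) < e"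
        using sg unfolding summable_Cauchy by blast
      have "W i \<omega> \<le> c * b i" if "i \<ge> m" for i
      proof -
        have "i < 8 ^ i" by (rule power_gt_expt) simp
        hence "sum (g \<omega>) {8^i..<8^Suc i} < e" using m[of "8^i" "8^Suc i"] that by auto
        hence "8 powr (1 + a) * sum (g \<omega>) {8^i..<8^Suc i} \<le> 8 powr (1 + a) * e"
          by (intro mult_left_mono) auto
        with Wg[of i \<omega>] have "W i \<omega> / b i \<le> c" by (simp add: e_def)
        thus ?thesis using b[of i] by (simp add: field_simps)
      qed
      thus "eventually (\<lambda>i. W i \<omega> \<le> c * b i) sequentially"
        by (auto simp: eventually_sequentially)
    qed
  qed
  have disj: "disjoint_family (\<lambda>i. {8^i..<8^Suc i :: nat})"
    unfolding disjoint_family_on_def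
  proof safe
    fix i j x assume "i \<noteq> j" "x \<in> {8^i..<8^Suc i :: nat}" "x \<in> {8^j..<8^Suc j :: nat}"
    hence "(8::nat) ^ i < 8 ^ Suc j" "(8::nat) ^ j < 8 ^ Suc i" by auto
    hence "i < Suc j" "j < Suc i"
      by (simp_all only: power_strict_increasing_iff[of "8::nat"] one_less_numeral_iff semiring_norm)
    with \<open>i \<noteq> j\<close> show "x \<in> {}" by simp
  qed
  have "indep_vars (\<lambda>i. PiM {8^i..<8^Suc i} (\<lambda>_. borel))
      (\<lambda>i \<omega>. restrict (\<lambda>l. Xs l \<omega>) {8^i..<8^Suc i}) UNIV"
    by (intro indep_vars_restrict[OF ind] disj) auto
  hence "indep_vars (\<lambda>_. borel) (\<lambda>i \<omega>. Sw i (restrict (\<lambda>l. Xs l \<omega>) {8^i..<8^Suc i}) / b i) UNIV"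
  proof (rule indep_vars_compose2)
    fix i :: nat
    show "(\<lambda>x. Sw i x / b i) \<in> borel_measurable (PiM {8^i..<8^Suc i} (\<lambda>_. borel))"
      unfolding Sw_def
      by (intro borel_measurable_divide borel_measurable_sum borel_measurable_norm
          borel_measurable_const measurable_component_singleton) auto
  qed
  moreover have "Sw i (restrict x {8^i..<8^Suc i}) = Sw i x" for i x
    unfolding Sw_def by (intro arg_cong2[where f="(/)"] refl sum.cong arg_cong[where f=norm]) auto
  ultimately have indW: "indep_vars (\<lambda>_. borel) (\<lambda>i \<omega>. W i \<omega> / b i) UNIV"
    by (simp add: W_def)
  have "summable (\<lambda>i. prob {\<omega>\<in>space M. W i \<omega> / b i > 1/2})"
  proof (rule borel_cantelli_indep_vars[OF indW])
    show "AE \<omega> in M. eventually (\<lambda>i. W i \<omega> / b i \<le> 1/2) sequentially"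
      using W0
    proof eventually_elim
      case (elim \<omega>)
      hence "eventually (\<lambda>i. W i \<omega> \<le> 1/2 * b i) sequentially"
        by (intro elim[rule_format]) simp
      thus ?case by eventually_elim (use b in \<open>simp add: field_simps\<close>)
    qed
  qed
  hence sumW: "summable (\<lambda>i. prob {\<omega>\<in>space M. b i / 2 < W i \<omega>})"
    using b by (simp add: field_simps)
  have limW: "(\<lambda>i. prob {\<omega>\<in>space M. b i / 4 < W i \<omega>}) \<longlonglongrightarrow> 0"
  proof (rule prob_tendsto_0_if_AE_eventually_not(2))
    show "AE \<omega> in M. eventually (\<lambda>i. \<not> b i / 4 < W i \<omega>) sequentially"
      using W0
    proof eventually_elim
      case (elim \<omega>)
      hence "eventually (\<lambda>i. W i \<omega> \<le> 1/4 * b i) sequentially"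
        by (intro elim[rule_format]) simp
      thus ?case by eventually_elim simp
    qed
  qed measurable
  have b_inf: "filterlim b at_top sequentially"
  proof -
    have "1 < norm (8 powr a)" using a by simp
    hence "filterlim (\<lambda>i. norm ((8 powr a) ^ i)) at_top sequentially"
      by (intro filterlim_at_infinity_imp_norm_at_top filterlim_realpow_sequentially_gt1)
    moreover have "norm ((8 powr a) ^ i) = b i" for i
      by (simp add: b_def powr_power powr_powr mult.commute flip: powr_realpow)
    ultimately show ?thesis by simp
  qed
  have limX: "(\<lambda>i. prob {\<omega>\<in>space M. b i / 4 < norm (X \<omega>)}) \<longlonglongrightarrow> 0"
  proof (rule prob_tendsto_0_if_AE_eventually_not(2))
    show "AE \<omega> in M. eventually (\<lambda>i. \<not> b i / 4 < norm (X \<omega>)) sequentially"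
    proof (rule AE_I2)
      fix \<omega>
      have "eventually (\<lambda>i. 4 * norm (X \<omega>) \<le> b i) sequentially"
        using b_inf unfolding filterlim_at_top by blast
      thus "eventually (\<lambda>i. \<not> b i / 4 < norm (X \<omega>)) sequentially"
        by eventually_elim simp
    qed
  qed measurable
  have probX: "prob {\<omega>\<in>space M. c < norm (Xs k \<omega>)} = prob {\<omega>\<in>space M. c < norm (X \<omega>)}" for c k
  proof -
    have "prob {\<omega>\<in>space M. c < norm (Y \<omega>)} = measure (distr M borel Y) {x. c < norm x}"
      if [measurable]: "Y \<in> borel_measurable M" for Y :: "'a \<Rightarrow> 'b"
      by (subst measure_distr) (auto intro!: arg_cong[where f=prob])
    from this[of "Xs k"] this[of X] show ?thesis by (simp add: distr)
  qed
  define q where "q i = prob {\<omega>\<in>space M. b i < norm (X \<omega>)}" for i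
  \<comment> \<open>The two bounds 1/8 are the smallness hypotheses of
    \<open>single_jump_lower_bound\<close>; the bound 1/32 serves to exclude the case that
    \<open>2 * ?N * q i\<close> exceeds 1/4.\<close>
  have "eventually (\<lambda>i. prob {\<omega>\<in>space M. b i / 4 < W i \<omega>} < 1/8) sequentially"
    using limW by (rule order_tendstoD) simp
  moreover have "eventually (\<lambda>i. prob {\<omega>\<in>space M. b i / 4 < norm (X \<omega>)} < 1/8) sequentially"
    using limX by (rule order_tendstoD) simp
  moreover have "eventually (\<lambda>i. prob {\<omega>\<in>space M. b i / 2 < W i \<omega>} < 1/32) sequentially"
    using summable_LIMSEQ_zero[OF sumW] by (rule order_tendstoD) simp
  ultimately have "eventually (\<lambda>i. norm (8 ^ i * q i) \<le> prob {\<omega>\<in>space M. b i / 2 < W i \<omega>}) sequentially"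
  proof eventually_elim
    case (elim i)
    let ?N = "8 ^ i :: nat"
    have q0: "q i \<ge> 0" by (simp add: q_def)
    \<comment> \<open>Limits the loss from rounding \<open>m\<close> down below:
      \<open>m * q i\<close> stays above 1/4 - 1/8.\<close>
    have q8: "q i \<le> 1/8"
    proof -
      have "q i \<le> prob {\<omega>\<in>space M. b i / 4 < norm (X \<omega>)}"
        unfolding q_def using b[of i] by (intro finite_measure_mono) auto
      with elim show ?thesis by simp
    qed
    \<comment> \<open>The number \<open>m\<close> of indices is left free because the requirement
      \<open>m * q i <= 1/4\<close> is not yet known for all \<open>2 * ?N\<close> common
      indices.\<close>
    have jump: "real m * q i / 2 \<le> prob {\<omega>\<in>space M. b i / 2 < W i \<omega>}"
      if "m \<le> 2 * ?N" "real m * q i \<le> 1/4" for m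
    proof -
      have "real (card {2 * ?N..<2 * ?N + m}) * q i / 2 \<le> prob {\<omega>\<in>space M. b i / 2 < W i \<omega>}"
        using elim that probX[of "b i / 4"]
        by (intro single_jump_lower_bound[OF ind, where N="?N" and A="\<lambda>d. {?N + d..<4 * ?N + d}"])
          (auto simp: probX q_def W_def Sw_def)
      thus ?thesis by simp
    qed
    show ?case
    proof (cases "real (2 * ?N) * q i \<le> 1/4")
      \<comment> \<open>Taking all \<open>2 * ?N\<close> indices cancels the factor 1/2 in
        \<open>jump\<close>.\<close>
      case True
      from jump[OF _ True] q0 show ?thesis by simp
    next
      case False
      hence qpos: "q i > 0" using q0 by (cases "q i = 0") auto
      \<comment> \<open>Impossible for large \<^term>\<open>i\<close>: using only \<^term>\<open>m\<close> of the indices would give a bound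
        of at least \<open>1/16\<close>.\<close>
      define m where "m = nat \<lfloor>1 / (4 * q i)\<rfloor>"
      have m: "real m \<le> 1 / (4 * q i)" "1 / (4 * q i) - 1 < real m"
        using qpos by (simp_all add: m_def)
      have mq: "real m * q i \<le> 1/4" "1/4 - q i < real m * q i"
        using m qpos by (simp_all add: field_simps)
      have "real m * q i < real (2 * ?N) * q i" using mq(1) False by linarith
      hence "m \<le> 2 * ?N" using qpos by (simp only: mult_less_cancel_right_pos of_nat_less_iff less_imp_le)
      from jump[OF this mq(1)] mq q8 elim show ?thesis by simp
    qed
  qed
  hence sumq: "summable (\<lambda>i. 8 ^ i * q i)"
    using sumW by (rule summable_comparison_test_ev)
  have ev: "8 ^ i < norm x powr p \<longleftrightarrow> b i < norm x" for i and x :: 'b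
  proof -
    have "8 ^ i < norm x powr p \<longleftrightarrow> b i powr p < norm x powr p"
      using p by (simp add: b_def a_def powr_powr)
    also have "\<dots> \<longleftrightarrow> b i < norm x"
      using p b[of i] by (meson less_imp_le norm_ge_zero not_less powr_less_mono2 powr_mono2)
    finally show ?thesis .
  qed
  have "(\<integral>\<^sup>+ \<omega>. ennreal (norm (X \<omega>) powr p) \<partial>M)
      \<le> (\<integral>\<^sup>+ \<omega>. 1 + (\<Sum>i. ennreal (8 ^ Suc i) * indicator {8 ^ i<..} (norm (X \<omega>) powr p)) \<partial>M)"
    by (intro nn_integral_mono ennreal_le_geometric_tail_sum)
  also have "\<dots> = 1 + (\<Sum>i. \<integral>\<^sup>+ \<omega>. ennreal (8 ^ Suc i) * indicator {8 ^ i<..} (norm (X \<omega>) powr p) \<partial>M)"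
    by (subst nn_integral_add) (auto simp: nn_integral_suminf emeasure_space_1)
  also have "(\<lambda>i. \<integral>\<^sup>+ \<omega>. ennreal (8 ^ Suc i) * indicator {8 ^ i<..} (norm (X \<omega>) powr p) \<partial>M)
      = (\<lambda>i. ennreal (8 * (8 ^ i * q i)))"
  proof
    fix i
    have "(\<integral>\<^sup>+ \<omega>. ennreal (8 ^ Suc i) * indicator {8 ^ i<..} (norm (X \<omega>) powr p) \<partial>M)
        = (\<integral>\<^sup>+ \<omega>. ennreal (8 ^ Suc i) * indicator {\<omega>\<in>space M. b i < norm (X \<omega>)} \<omega> \<partial>M)"
      by (intro nn_integral_cong) (auto simp: ev indicator_def)
    also have "\<dots> = ennreal (8 ^ Suc i) * ennreal (q i)"
      by (simp add: nn_integral_cmult q_def emeasure_eq_measure)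
    also have "\<dots> = ennreal (8 * (8 ^ i * q i))"
      by (simp add: q_def mult.assoc flip: ennreal_mult)
    finally show "(\<integral>\<^sup>+ \<omega>. ennreal (8 ^ Suc i) * indicator {8 ^ i<..} (norm (X \<omega>) powr p) \<partial>M)
        = ennreal (8 * (8 ^ i * q i))" .
  qed
  also have "(\<Sum>i. ennreal (8 * (8 ^ i * q i))) = ennreal (\<Sum>i. 8 * (8 ^ i * q i))"
    using sumq by (intro suminf_ennreal2 summable_mult) (auto simp: q_def)
  finally show ?thesis by (auto simp: less_top[symmetric] top_unique)
qed

end

section \<open>Both equivalences\<close>

theorem theorem2p4:
  fixes M :: "'a measure" and X :: "'a \<Rightarrow> 'b::{banach, second_countable_topology}"
    and Xs :: "nat \<Rightarrow> 'a \<Rightarrow> 'b" and p :: real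
  assumes "prob_space M"
    and "0 < p" and "p < 1"
    and "X \<in> borel_measurable M"
    and "\<And>n. Xs n \<in> borel_measurable M"
    and "prob_space.indep_vars M (\<lambda>_. borel) Xs UNIV"
    and "\<And>n. distr M borel (Xs n) = distr M borel X"
  shows "((AE \<omega> in M. summable (\<lambda>n. (1 / real (Suc n)) *
              (norm (partial_sum Xs (Suc n) \<omega>) / real (Suc n) powr (1 / p))))
          \<longleftrightarrow> (\<integral>\<^sup>+ \<omega>. ennreal (norm (X \<omega>) powr p) \<partial>M) < \<infinity>)
       \<and> (((\<Sum>n. ennreal (1 / real (Suc n)) *
              ((\<integral>\<^sup>+ \<omega>. ennreal (norm (partial_sum Xs (Suc n) \<omega>)) \<partial>M)
                / ennreal (real (Suc n) powr (1 / p)))) < \<infinity>)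
          \<longleftrightarrow> (\<integral>\<^sup>+ \<omega>. ennreal (norm (X \<omega>)) \<partial>M) < \<infinity>)"
proof (intro conjI iffI)
  interpret prob_space M by fact
  note [measurable] = assms(4,5)
  show "(\<integral>\<^sup>+ \<omega>. ennreal (norm (X \<omega>) powr p) \<partial>M) < \<infinity>"
    if "AE \<omega> in M. summable (\<lambda>n. (1 / real (Suc n)) *
              (norm (partial_sum Xs (Suc n) \<omega>) / real (Suc n) powr (1 / p)))"
    by (rule expectation_powr_finite_if_AE_summable[OF assms(2,4,5,6,7) that])
  have norm_partial_sum_le: "norm (partial_sum Xs n \<omega>) \<le> (\<Sum>k<n. norm (Xs k \<omega>))" for n \<omega>
    unfolding partial_sum_def by (rule norm_sum)
  show "AE \<omega> in M. summable (\<lambda>n. (1 / real (Suc n)) *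
              (norm (partial_sum Xs (Suc n) \<omega>) / real (Suc n) powr (1 / p)))"
    if fin: "(\<integral>\<^sup>+ \<omega>. ennreal (norm (X \<omega>) powr p) \<partial>M) < \<infinity>"
    using AE_summable_weighted_norms[where Xs=Xs, OF assms(2,3,4,5,7) fin]
  proof eventually_elim
    case (elim \<omega>)
    \<comment> \<open>The partial sums are dominated by sums of norms, which reduces the claim to a
      real series.\<close>
    have "summable (\<lambda>n. 1 / real (Suc n) * ((\<Sum>k<Suc n. norm (Xs k \<omega>)) / real (Suc n) powr (1 / p)))"
      using assms elim by (intro summable_weighted_partial_sums) auto
    thus ?case
    proof (rule summable_comparison_test'[where N=0])
      fix n
      show "norm (1 / real (Suc n) * (norm (partial_sum Xs (Suc n) \<omega>) / real (Suc n) powr (1 / p)))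
          \<le> 1 / real (Suc n) * ((\<Sum>k<Suc n. norm (Xs k \<omega>)) / real (Suc n) powr (1 / p))"
        unfolding real_norm_def
      proof (subst abs_of_nonneg)
        show "1 / real (Suc n) * (norm (partial_sum Xs (Suc n) \<omega>) / real (Suc n) powr (1 / p))
            \<le> 1 / real (Suc n) * ((\<Sum>k<Suc n. norm (Xs k \<omega>)) / real (Suc n) powr (1 / p))"
          by (intro mult_left_mono divide_right_mono norm_partial_sum_le) auto
      qed simp
    qed
  qed
  have EXs: "(\<integral>\<^sup>+ \<omega>. ennreal (norm (Xs k \<omega>)) \<partial>M) = (\<integral>\<^sup>+ \<omega>. ennreal (norm (X \<omega>)) \<partial>M)" for k
  proof -
    have "(\<integral>\<^sup>+ \<omega>. ennreal (norm (Xs k \<omega>)) \<partial>M) = (\<integral>\<^sup>+ x. ennreal (norm x) \<partial>distr M borel (Xs k))"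
      by (subst nn_integral_distr) auto
    also have "\<dots> = (\<integral>\<^sup>+ x. ennreal (norm x) \<partial>distr M borel X)" by (simp add: assms(7))
    also have "\<dots> = (\<integral>\<^sup>+ \<omega>. ennreal (norm (X \<omega>)) \<partial>M)" by (subst nn_integral_distr) auto
    finally show ?thesis .
  qed
  let ?F = "\<lambda>n. ennreal (1 / real (Suc n)) *
              ((\<integral>\<^sup>+ \<omega>. ennreal (norm (partial_sum Xs (Suc n) \<omega>)) \<partial>M)
                / ennreal (real (Suc n) powr (1 / p)))"
  show "(\<integral>\<^sup>+ \<omega>. ennreal (norm (X \<omega>)) \<partial>M) < \<infinity>" if "(\<Sum>n. ?F n) < \<infinity>"
  proof -
    \<comment> \<open>The term with index 0 belongs to the partial sum of length 1 and has weight 1,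
      so it equals the expected norm of \<open>X\<close>.\<close>
    have "(\<integral>\<^sup>+ \<omega>. ennreal (norm (X \<omega>)) \<partial>M) = (\<Sum>n\<in>{0}. ?F n)"
      using EXs[of 0] by (simp add: partial_sum_def divide_ennreal_def)
    also have "\<dots> \<le> (\<Sum>n. ?F n)" by (intro sum_le_suminf) auto
    finally show ?thesis using that by simp
  qed
  show "(\<Sum>n. ?F n) < \<infinity>" if fin: "(\<integral>\<^sup>+ \<omega>. ennreal (norm (X \<omega>)) \<partial>M) < \<infinity>"
  proof -
    obtain e where e: "e \<ge> 0" "(\<integral>\<^sup>+ \<omega>. ennreal (norm (X \<omega>)) \<partial>M) = ennreal e"
      using fin by (cases "\<integral>\<^sup>+ \<omega>. ennreal (norm (X \<omega>)) \<partial>M") auto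
    \<comment> \<open>The expected norm of a sum of \<open>Suc n\<close> terms is at most
      \<open>Suc n * e\<close>. This cancels the factor \<open>1 / Suc n\<close> and leaves a series
      with exponent 1/p > 1.\<close>
    have le: "?F n \<le> ennreal (e * real (Suc n) powr (- (1 / p)))" for n
    proof -
      have "(\<integral>\<^sup>+ \<omega>. ennreal (norm (partial_sum Xs (Suc n) \<omega>)) \<partial>M)
          \<le> (\<integral>\<^sup>+ \<omega>. (\<Sum>k<Suc n. ennreal (norm (Xs k \<omega>))) \<partial>M)"
        by (intro nn_integral_mono) (simp only: sum_ennreal norm_ge_zero norm_partial_sum_le ennreal_leI)
      also have "\<dots> = (\<Sum>k<Suc n. \<integral>\<^sup>+ \<omega>. ennreal (norm (Xs k \<omega>)) \<partial>M)"
        by (intro nn_integral_sum) auto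
      also have "\<dots> = ennreal (real (Suc n) * e)"
        using e by (simp only: EXs sum_constant card_lessThan) (simp add: ennreal_mult ennreal_of_nat_eq_real_of_nat del: of_nat_Suc)
      finally have "?F n \<le> ennreal (1 / real (Suc n)) *
          (ennreal (real (Suc n) * e) / ennreal (real (Suc n) powr (1 / p)))"
        by (intro mult_left_mono divide_right_mono_ennreal) auto
      also have "\<dots> = ennreal (1 / real (Suc n) * (real (Suc n) * e / real (Suc n) powr (1 / p)))"
        using e by (simp add: divide_ennreal flip: ennreal_mult)
      also have "1 / real (Suc n) * (real (Suc n) * e / real (Suc n) powr (1 / p)) = e * real (Suc n) powr (- (1 / p))"
        by (simp add: powr_minus divide_simps)
      finally show ?thesis .
    qed
    have "summable (\<lambda>n. real n powr (- (1 / p)))"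
      using assms by (simp add: summable_real_powr_iff)
    hence "summable (\<lambda>n. real (Suc n) powr (- (1 / p)))"
      by (subst summable_Suc_iff)
    hence s: "summable (\<lambda>n. e * real (Suc n) powr (- (1 / p)))"
      by (rule summable_mult)
    have "(\<Sum>n. ?F n) \<le> (\<Sum>n. ennreal (e * real (Suc n) powr (- (1 / p))))"
      by (intro suminf_le le) auto
    also have "\<dots> = ennreal (\<Sum>n. e * real (Suc n) powr (- (1 / p)))"
      using s e by (intro suminf_ennreal2) auto
    finally show ?thesis by (auto simp: less_top[symmetric] top_unique)
  qed
qed

end
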